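(* If $G$ and $H$ are connected graphs of order at least $2$, then $$\mathrm{gp}_{\rm o}(G)\,\mathrm{gp}_{\rm o}(H)\le \mathrm{gp}_{\rm o}(G\boxtimes H)\le b(G)\,b(H).$$ Moreover, if $G$ and $H$ are block graphs, then the lower and upper bounds coincide.
   Context: All graphs are finite and simple. For $X\subseteq V(G)$, two vertices $u,v$ are $X$-positionable if no shortest $u,v$-path has an internal vertex in $X$. $X$ is an outer general position set if every two vertices of $X$ are $X$-positionable and every $u\in X$, $v\in V(G)\setminus X$ are $X$-positionable; $\mathrm{gp}_{\rm o}(G)$ is the maximum cardinality of such a set. A vertex $u$ is maximally distant from $v$ if every neighbour $w$ of $u$ satisfies $d_G(v,w)\le d_G(u,v)$; $u,v$ are mutually maximally distant (MMD) if each is maximally distant from the other. The boundary $\partial(G)$ is the set of vertices that are MMD with some other vertex, and $b(G)=|\partial(G)|$. A block graph is a connected graph in which every block (maximal 2-connected subgraph or bridge) is complete. The strong product $G\boxtimes H$ has vertex set $V(G)\times V(H)$, with $(g,h)$ and $(g',h')$ adjacent iff either $g=g'$ and $hh'\in E(H)$, or $gg'\in E(G)$ and $h=h'$, or $gg'\in E(G)$ and $hh'\in E(H)$. *)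

theory Defs
  imports "Graph_Theory.Graph_Theory"
begin

text \<open>
  A finite simple graph is a \<^term>\<open>G :: 'a pair_pre_digraph\<close> satisfying \<^const>\<open>pair_graph\<close>: the
  vertex set is finite, and the arc relation is irreflexive and symmetric, so an edge is a pair of
  opposite arcs. Names such as \<open>Digraph_Component.connected\<close> are qualified because the
  topological notion of the same base name is also in scope.
\<close>

section \<open>Distance and shortest paths\<close>

definition path_between :: "'a pair_pre_digraph \<Rightarrow> 'a \<Rightarrow> 'a vwalk \<Rightarrow> 'a \<Rightarrow> bool" where
  "path_between G u p v \<longleftrightarrow> vpath p (with_proj G) \<and> hd p = u \<and> last p = v"

text \<open>Unspecified if there is no path; it is only meaningful within a connected component.\<close>

definition graph_dist :: "'a pair_pre_digraph \<Rightarrow> 'a \<Rightarrow> 'a \<Rightarrow> nat" where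
  "graph_dist G u v = (LEAST n. \<exists>p. path_between G u p v \<and> vwalk_length p = n)"

definition shortest_path :: "'a pair_pre_digraph \<Rightarrow> 'a \<Rightarrow> 'a vwalk \<Rightarrow> 'a \<Rightarrow> bool" where
  "shortest_path G u p v \<longleftrightarrow> path_between G u p v \<and> vwalk_length p = graph_dist G u v"

definition internal_verts :: "'a vwalk \<Rightarrow> 'a set" where
  "internal_verts p = set (butlast (tl p))"

section \<open>Outer general position sets\<close>

definition positionable :: "'a pair_pre_digraph \<Rightarrow> 'a set \<Rightarrow> 'a \<Rightarrow> 'a \<Rightarrow> bool" where
  "positionable G X u v \<longleftrightarrow> \<not> (\<exists>p. shortest_path G u p v \<and> internal_verts p \<inter> X \<noteq> {})"

definition outer_general_position :: "'a pair_pre_digraph \<Rightarrow> 'a set \<Rightarrow> bool" where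
  "outer_general_position G X \<longleftrightarrow> X \<subseteq> pverts G \<and>
     (\<forall>u\<in>X. \<forall>v\<in>X. u \<noteq> v \<longrightarrow> positionable G X u v) \<and>
     (\<forall>u\<in>X. \<forall>v\<in>pverts G - X. positionable G X u v)"

definition gp_outer :: "'a pair_pre_digraph \<Rightarrow> nat" where
  "gp_outer G = Max {card X | X. outer_general_position G X}"

section \<open>The boundary\<close>

text \<open>\<open>maximally_distant G u v\<close>: \<open>u\<close> is maximally distant from \<open>v\<close>.\<close>

definition maximally_distant :: "'a pair_pre_digraph \<Rightarrow> 'a \<Rightarrow> 'a \<Rightarrow> bool" where
  "maximally_distant G u v \<longleftrightarrow>
     (\<forall>w. (u, w) \<in> parcs G \<longrightarrow> graph_dist G v w \<le> graph_dist G u v)"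

definition mutually_maximally_distant :: "'a pair_pre_digraph \<Rightarrow> 'a \<Rightarrow> 'a \<Rightarrow> bool" where
  "mutually_maximally_distant G u v \<longleftrightarrow> maximally_distant G u v \<and> maximally_distant G v u"

definition graph_boundary :: "'a pair_pre_digraph \<Rightarrow> 'a set" where
  "graph_boundary G =
     {u \<in> pverts G. \<exists>v\<in>pverts G. v \<noteq> u \<and> mutually_maximally_distant G u v}"

definition boundary_number :: "'a pair_pre_digraph \<Rightarrow> nat" where
  "boundary_number G = card (graph_boundary G)"

section \<open>Block graphs\<close>

text \<open>
  As usual, 2-connected means: more than two vertices, connected, and no single vertex
  whose removal disconnects the graph.
\<close>

definition two_connected :: "('a, 'b) pre_digraph \<Rightarrow> bool" where
  "two_connected B \<longleftrightarrow> graph B \<and> card (verts B) > 2 \<and> Digraph_Component.connected B \<and>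
     (\<forall>v\<in>verts B. Digraph_Component.connected (pre_digraph.del_vert B v))"

text \<open>A bridge is an edge separating its ends.\<close>

definition bridge :: "'a pair_pre_digraph \<Rightarrow> 'a \<Rightarrow> 'a \<Rightarrow> bool" where
  "bridge G u v \<longleftrightarrow> (u, v) \<in> parcs G \<and>
     \<not> reachable (with_proj \<lparr>pverts = pverts G, parcs = parcs G - {(u, v), (v, u)}\<rparr>) u v"

definition block :: "'a pair_pre_digraph \<Rightarrow> 'a pair_pre_digraph \<Rightarrow> bool" where
  "block G B \<longleftrightarrow> pre_digraph.max_subgraph (with_proj G) two_connected (with_proj B) \<or>
     (\<exists>u v. bridge G u v \<and> B = \<lparr>pverts = {u, v}, parcs = {(u, v), (v, u)}\<rparr>)"

definition block_graph :: "'a pair_pre_digraph \<Rightarrow> bool" where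
  "block_graph G \<longleftrightarrow> pair_graph G \<and> Digraph_Component.connected (with_proj G) \<and>
     (\<forall>B. block G B \<longrightarrow> complete_digraph (card (pverts B)) (with_proj B))"

section \<open>The strong product\<close>

definition strong_product ::
  "'a pair_pre_digraph \<Rightarrow> 'b pair_pre_digraph \<Rightarrow> ('a \<times> 'b) pair_pre_digraph"
  (infixl "\<boxtimes>" 70) where
  "G \<boxtimes> H = \<lparr>pverts = pverts G \<times> pverts H,
     parcs = {((g, h), (g', h')) | g h g' h'.
       (g \<in> pverts G \<and> g = g' \<and> (h, h') \<in> parcs H) \<or>
       ((g, g') \<in> parcs G \<and> h \<in> pverts H \<and> h = h') \<or>
       ((g, g') \<in> parcs G \<and> (h, h') \<in> parcs H)}\<rparr>"

lemma pair_graph_strong_product: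
  assumes "pair_graph G" and "pair_graph H"
  shows "pair_graph (G \<boxtimes> H)"
proof -
  interpret G: pair_graph G by fact
  interpret H: pair_graph H by fact
  let ?P = "G \<boxtimes> H"
  have sub: "parcs ?P \<subseteq> pverts ?P \<times> pverts ?P"
    by (auto simp: strong_product_def dest: G.in_arcsD1 G.in_arcsD2 H.in_arcsD1 H.in_arcsD2)
  have fin: "finite (pverts ?P)"
    by (simp add: strong_product_def)
  have "sym (parcs ?P)"
    by (auto simp: strong_product_def sym_def intro: G.arcs_symmetric H.arcs_symmetric)
  moreover have "fst e \<noteq> snd e" if "e \<in> parcs ?P" for e
    using that by (auto simp: strong_product_def dest: G.pair_no_loops H.pair_no_loops)
  moreover have "finite (parcs ?P)"
    using sub fin by (meson finite_SigmaI finite_subset)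
  ultimately show ?thesis
    using sub fin by unfold_locales (auto simp: symmetric_def)
qed

end

theory Submission
  imports Defs
begin

text \<open>
  A set is an outer general position set iff its vertices are pairwise (mutually) maximally
  distant, so \<open>gp_outer\<close> is the clique number of the MMD relation. The distance in the strong
  product is the maximum of the two factor distances, whence a product of MMD cliques is an MMD
  clique. Conversely, two members of an MMD clique of \<open>G \<boxtimes> H\<close> have MMD projections in the factor
  where their distance is larger, and in both factors in case of a tie. Hence the first coordinates
  of all members lie in the boundary of \<open>G\<close>, or the second ones in that of \<open>H\<close>; say the first.
  Members with equal first coordinate then have second coordinates in the boundary of \<open>H\<close>, so
  replacing the other second coordinates by a fixed boundary vertex is injective.

  In a block graph, if \<open>u\<close> is maximally distant from some \<open>v \<noteq> u\<close>, all neighbours of \<open>u\<close> are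
  joined to \<open>v\<close> by paths avoiding \<open>u\<close>. Two of them lie with \<open>u\<close> on a cycle, hence in a common
  block, so they are adjacent; and a vertex whose neighbours form a clique is maximally distant
  from every other vertex. So the whole boundary is an MMD clique.
\<close>

section \<open>Walks and distance\<close>

text \<open>Idle steps pad a shorter walk to length exactly \<open>n\<close>. Walks of different
  lengths in two factors can thus be run in parallel.\<close>

lemma relpow_Un_Id: "(u, v) \<in> (E \<union> Id) ^^ n \<longleftrightarrow> (\<exists>m\<le>n. (u, v) \<in> E ^^ m)"
proof (induction n arbitrary: v)
  case (Suc n)
  have "(u, v) \<in> (E \<union> Id) ^^ Suc n \<longleftrightarrow>
      (\<exists>w. (\<exists>m\<le>n. (u, w) \<in> E ^^ m) \<and> ((w, v) \<in> E \<or> w = v))"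
    by (auto simp: relcomp_unfold Suc)
  also have "\<dots> \<longleftrightarrow> (\<exists>m\<le>Suc n. (u, v) \<in> E ^^ m)"
  proof
    assume "\<exists>w. (\<exists>m\<le>n. (u, w) \<in> E ^^ m) \<and> ((w, v) \<in> E \<or> w = v)"
    then show "\<exists>m\<le>Suc n. (u, v) \<in> E ^^ m"
      by (metis Suc_le_mono le_SucI relpow_Suc_I)
  next
    assume "\<exists>m\<le>Suc n. (u, v) \<in> E ^^ m"
    then obtain m where m: "m \<le> Suc n" "(u, v) \<in> E ^^ m" by blast
    show "\<exists>w. (\<exists>m\<le>n. (u, w) \<in> E ^^ m) \<and> ((w, v) \<in> E \<or> w = v)"
    proof (cases "m \<le> n")
      case False
      then have "m = Suc n" using m by simp
      then obtain w where "(u, w) \<in> E ^^ n" "(w, v) \<in> E" using m by auto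
      then show ?thesis by auto
    qed (use m in blast)
  qed
  finally show ?case .
qed auto

lemma relpow_sym:
  assumes "sym R" and "(x, y) \<in> R ^^ n"
  shows "(y, x) \<in> R ^^ n"
  using assms(2)
proof (induction n arbitrary: y)
  case (Suc n)
  from Suc.prems obtain z where "(x, z) \<in> R ^^ n" "(z, y) \<in> R" by (rule relpow_Suc_E)
  then show ?case using Suc.IH assms(1) by (meson relpow_Suc_I2 symD)
qed auto

lemma successively_relpow:
  assumes "successively (\<lambda>x y. (x, y) \<in> E) p" and "p \<noteq> []"
  shows "(hd p, last p) \<in> E ^^ (length p - 1)"
  using assms
proof (induction p rule: induct_list012)
  case (3 x y zs)
  then have "(x, y) \<in> E" "(y, last (y # zs)) \<in> E ^^ length zs" by auto
  then show ?case using relpow_Suc_I2 by fastforce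
qed auto

lemma relpow_successively:
  assumes "(u, v) \<in> E ^^ n"
  shows "\<exists>p. successively (\<lambda>x y. (x, y) \<in> E) p \<and> p \<noteq> [] \<and> hd p = u \<and> last p = v \<and> length p = Suc n"
  using assms
proof (induction n arbitrary: v)
  case 0
  then show ?case by (intro exI[of _ "[u]"]) auto
next
  case (Suc n)
  then obtain w where w: "(u, w) \<in> E ^^ n" "(w, v) \<in> E" by auto
  from Suc.IH[OF w(1)] obtain p where
    "successively (\<lambda>x y. (x, y) \<in> E) p" "p \<noteq> []" "hd p = u" "last p = w" "length p = Suc n" by blast
  then show ?case using w(2) by (intro exI[of _ "p @ [v]"]) (auto simp: successively_append_iff)
qed

text \<open>Intersecting with \<open>S \<times> S\<close> records which vertices are visited, as
  needed for connectivity after a vertex has been deleted.\<close>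

lemma successively_rtrancl:
  assumes "successively (\<lambda>x y. (x, y) \<in> E) p" and "x \<in> set p" and "set p \<subseteq> S"
  shows "(hd p, x) \<in> (E \<inter> S \<times> S)\<^sup>*"
  using assms
proof (induction p rule: induct_list012)
  case (3 y z zs)
  show ?case
  proof (cases "x = y")
    case False
    then have "(z, x) \<in> (E \<inter> S \<times> S)\<^sup>*" using 3 by auto
    moreover have "(y, z) \<in> E \<inter> S \<times> S" using 3 by auto
    ultimately show ?thesis unfolding list.sel by (rule converse_rtrancl_into_rtrancl[rotated])
  qed auto
qed auto

section \<open>Walks and paths as vertex lists\<close>

lemma set_vwalk_arcs_subset_iff:
  "set (vwalk_arcs p) \<subseteq> E \<longleftrightarrow> successively (\<lambda>x y. (x, y) \<in> E) p"
  by (induction p rule: induct_list012) auto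

lemma vwalk_with_proj_iff:
  "vwalk p (with_proj G) \<longleftrightarrow>
     set p \<subseteq> pverts G \<and> successively (\<lambda>x y. (x, y) \<in> parcs G) p \<and> p \<noteq> []"
  by (simp add: vwalk_def set_vwalk_arcs_subset_iff)

text \<open>Cutting out repetitions only drops entries. Hence arbitrary walks bound
  \<open>graph_dist\<close>, although it minimises over paths.\<close>

lemma length_vwalk_to_vpath: "length (vwalk_to_vpath p) \<le> length p"
proof (induction p rule: vwalk_to_vpath_induct3)
  case (in_set x xs)
  then show ?case using length_dropWhile_le[of "\<lambda>y. y \<noteq> x" xs] by auto
qed auto

lemma path_between_iff:
  "path_between G u p v \<longleftrightarrow> set p \<subseteq> pverts G \<and> successively (\<lambda>x y. (x, y) \<in> parcs G) p \<and>
     p \<noteq> [] \<and> distinct p \<and> hd p = u \<and> last p = v"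
  by (auto simp: path_between_def vpath_def vwalk_with_proj_iff)

lemma successively_arcs_verts:
  assumes "pair_graph G" and "successively (\<lambda>x y. (x, y) \<in> parcs G) p" and "hd p \<in> pverts G"
  shows "set p \<subseteq> pverts G"
proof -
  interpret pair_graph G by fact
  show ?thesis using assms(2,3)
    by (induction p rule: induct_list012) (auto dest: in_arcsD2)
qed

text \<open>Since arcs are symmetric, any two vertices are joined through the root
  \<open>r\<close>.\<close>

lemma connected_with_projI:
  assumes "pair_graph G" and r: "r \<in> pverts G"
    and reach: "\<And>x. x \<in> pverts G \<Longrightarrow> (r, x) \<in> (parcs G)\<^sup>*"
  shows "Digraph_Component.connected (with_proj G)"
proof -
  interpret pair_graph G by fact
  have "reachable (with_proj G) r x" if "x \<in> pverts G" for x
    using reach[OF that] r by (simp add: reachable_conv')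
  then have "reachable (with_proj G) x y" if "x \<in> pverts G" "y \<in> pverts G" for x y
    using that symmetric_reachable' reachable_trans by blast
  then show ?thesis
    using r unfolding Digraph_Component.connected_def
    by (intro strongly_connectedI) (auto simp: reachable_mk_symmetric_eq[OF sym_arcs])
qed

section \<open>Distance as a metric on a connected graph\<close>

locale connected_pair_graph = pair_graph +
  assumes connected: "Digraph_Component.connected (with_proj G)"
begin

lemma relpow_exists:
  assumes "u \<in> pverts G" and "v \<in> pverts G"
  shows "\<exists>n. (u, v) \<in> parcs G ^^ n"
proof -
  have "reachable (with_proj G) u v"
    using connected assms sym_arcs
    unfolding Digraph_Component.connected_def strongly_connected_def
    by (auto simp: reachable_mk_symmetric_eq)
  then show ?thesis
    using reachable_rtranclI rtrancl_imp_relpow by fastforce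
qed

lemma path_between_of_relpow:
  assumes "u \<in> pverts G" and "(u, v) \<in> parcs G ^^ n"
  shows "\<exists>p. path_between G u p v \<and> vwalk_length p \<le> n"
proof -
  obtain p where p: "successively (\<lambda>x y. (x, y) \<in> parcs G) p" "p \<noteq> []" "hd p = u" "last p = v"
      "length p = Suc n"
    using relpow_successively[OF assms(2)] by blast
  then have "vwalk p (with_proj G)"
    using successively_arcs_verts[OF pair_graph] assms(1) by (simp add: vwalk_with_proj_iff)
  then have "path_between G u (vwalk_to_vpath p) v"
    using p by (simp add: path_between_def vwalk_to_vpath_vpath vwalk_to_vpath_hd vwalk_to_vpath_last)
  then show ?thesis
    using length_vwalk_to_vpath[of p] p(5) by auto
qed

lemma shortest_path_exists:
  assumes "u \<in> pverts G" and "v \<in> pverts G"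
  shows "\<exists>p. shortest_path G u p v"
proof -
  have "\<exists>n p. path_between G u p v \<and> vwalk_length p = n"
    using relpow_exists[OF assms] path_between_of_relpow[OF assms(1)] by blast
  from LeastI_ex[OF this] show ?thesis
    unfolding shortest_path_def graph_dist_def .
qed

text \<open>Reflexive steps make distance bounds in the strong product split coordinatewise.\<close>

lemma graph_dist_le_iff:
  assumes "u \<in> pverts G" and "v \<in> pverts G"
  shows "graph_dist G u v \<le> n \<longleftrightarrow> (u, v) \<in> (parcs G \<union> Id) ^^ n"
proof
  assume "graph_dist G u v \<le> n"
  moreover obtain p where "shortest_path G u p v" using shortest_path_exists[OF assms] by blast
  then have "(u, v) \<in> parcs G ^^ graph_dist G u v"
    using successively_relpow[of "parcs G" p]
    by (auto simp: shortest_path_def path_between_iff)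
  ultimately show "(u, v) \<in> (parcs G \<union> Id) ^^ n" by (auto simp: relpow_Un_Id)
next
  assume "(u, v) \<in> (parcs G \<union> Id) ^^ n"
  then obtain m where "m \<le> n" "(u, v) \<in> parcs G ^^ m" by (auto simp: relpow_Un_Id)
  then obtain p where "path_between G u p v" "vwalk_length p \<le> n"
    using path_between_of_relpow[OF assms(1)] order_trans by metis
  moreover have "graph_dist G u v \<le> vwalk_length p"
    unfolding graph_dist_def by (rule Least_le) (use calculation in blast)
  ultimately show "graph_dist G u v \<le> n" by simp
qed

lemma graph_dist_eq_0_iff:
  "u \<in> pverts G \<Longrightarrow> v \<in> pverts G \<Longrightarrow> graph_dist G u v = 0 \<longleftrightarrow> u = v"
  using graph_dist_le_iff[of u v 0] by simp

lemma graph_dist_self [simp]: "u \<in> pverts G \<Longrightarrow> graph_dist G u u = 0"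
  by (simp add: graph_dist_eq_0_iff)

lemma graph_dist_commute:
  assumes "u \<in> pverts G" and "v \<in> pverts G"
  shows "graph_dist G u v = graph_dist G v u"
proof -
  have "graph_dist G y x \<le> graph_dist G x y" if "x \<in> pverts G" "y \<in> pverts G" for x y
  proof -
    have "sym (parcs G \<union> Id)"
      using arcs_symmetric by (auto simp: sym_def)
    moreover have "(x, y) \<in> (parcs G \<union> Id) ^^ graph_dist G x y"
      using graph_dist_le_iff[OF that] by blast
    ultimately have "(y, x) \<in> (parcs G \<union> Id) ^^ graph_dist G x y"
      by (rule relpow_sym)
    then show ?thesis
      unfolding graph_dist_le_iff[OF that(2,1)] .
  qed
  then show ?thesis by (intro antisym) (use assms in simp_all)
qed

lemma graph_dist_triangle:
  assumes "u \<in> pverts G" "v \<in> pverts G" "w \<in> pverts G"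
  shows "graph_dist G u w \<le> graph_dist G u v + graph_dist G v w"
proof -
  have "(u, v) \<in> (parcs G \<union> Id) ^^ graph_dist G u v" "(v, w) \<in> (parcs G \<union> Id) ^^ graph_dist G v w"
    using graph_dist_le_iff assms by blast+
  then show ?thesis
    using graph_dist_le_iff assms by (auto simp: relpow_add)
qed

lemma graph_dist_adj: "(u, v) \<in> parcs G \<Longrightarrow> graph_dist G u v \<le> 1"
  using graph_dist_le_iff[of u v 1] by (auto dest: in_arcsD1 in_arcsD2)

text \<open>Among \<open>graph_dist G u v\<close> reflexive steps from \<open>u\<close> to
  \<open>v\<close> the last is not idle, as dropping it would give a shorter walk. It therefore
  starts at a neighbour of \<open>v\<close> closer to \<open>u\<close>.\<close>

lemma graph_dist_pred:
  assumes "u \<in> pverts G" "v \<in> pverts G" "u \<noteq> v"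
  obtains w where "(w, v) \<in> parcs G" "Suc (graph_dist G u w) \<le> graph_dist G u v"
proof -
  have "graph_dist G u v \<noteq> 0"
    using graph_dist_eq_0_iff assms by simp
  then obtain n where n: "graph_dist G u v = Suc n" using not0_implies_Suc by blast
  then have "(u, v) \<in> (parcs G \<union> Id) ^^ Suc n"
    using graph_dist_le_iff[OF assms(1,2)] by (metis order_refl)
  then obtain w where w: "(u, w) \<in> (parcs G \<union> Id) ^^ n" "(w, v) \<in> parcs G \<union> Id"
    by (rule relpow_Suc_E)
  have "(u, v) \<notin> (parcs G \<union> Id) ^^ n"
    using n graph_dist_le_iff[OF assms(1,2), of n] by simp
  then have wv: "(w, v) \<in> parcs G"
    using w by auto
  moreover have "graph_dist G u w \<le> n"
    using w(1) graph_dist_le_iff[OF assms(1) in_arcsD1[OF wv]] by blast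
  ultimately show ?thesis using that n by simp
qed

lemma graph_dist_walk:
  assumes "successively (\<lambda>x y. (x, y) \<in> parcs G) p" "p \<noteq> []" "set p \<subseteq> pverts G"
  shows "graph_dist G (hd p) (last p) \<le> length p - 1"
proof -
  have "(hd p, last p) \<in> (parcs G \<union> Id) ^^ (length p - 1)"
    using successively_relpow[OF assms(1,2)] by (auto simp: relpow_Un_Id)
  moreover have "hd p \<in> pverts G" "last p \<in> pverts G" using assms(2,3) by auto
  ultimately show ?thesis using graph_dist_le_iff by blast
qed

end

section \<open>Outer general position and the boundary\<close>

context connected_pair_graph
begin

text \<open>If a neighbour \<open>w\<close> of \<open>u\<close> is farther from \<open>v\<close>
  than \<open>u\<close>, a shortest path from \<open>v\<close> to \<open>u\<close> extends by
  \<open>w\<close> to a shortest path with \<open>u\<close> inside. So \<open>v\<close> and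
  \<open>w\<close> are not positionable, and the two clauses of the definition exclude this for
  \<open>w\<close> inside and outside \<open>X\<close>.\<close>

lemma maximally_distant_if_positionable:
  assumes X: "outer_general_position G X" and uv: "u \<in> X" "v \<in> X" "u \<noteq> v"
  shows "maximally_distant G u v"
proof (rule ccontr)
  assume "\<not> maximally_distant G u v"
  then obtain w where w: "(u, w) \<in> parcs G" "graph_dist G u v < graph_dist G v w"
    unfolding maximally_distant_def by auto
  have V: "u \<in> pverts G" "v \<in> pverts G" "w \<in> pverts G"
    using X uv w(1) by (auto simp: outer_general_position_def dest: in_arcsD2)
  have "graph_dist G v w \<le> graph_dist G v u + 1"
    using graph_dist_triangle[of v u w] graph_dist_adj[OF w(1)] V by simp
  then have d: "graph_dist G v w = Suc (graph_dist G v u)"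
    using w(2) graph_dist_commute[OF V(1,2)] by simp
  obtain p where p: "shortest_path G v p u" using shortest_path_exists V by blast
  then have p': "set p \<subseteq> pverts G" "successively (\<lambda>x y. (x, y) \<in> parcs G) p"
      "p \<noteq> []" "distinct p" "hd p = v" "last p = u" "length p = Suc (graph_dist G v u)"
    by (auto simp: shortest_path_def path_between_iff) (metis Suc_pred length_greater_0_conv)
  \<comment> \<open>A prefix of \<open>p\<close> ending in \<open>w\<close> would put
    \<open>w\<close> no farther from \<open>v\<close> than \<open>u\<close> is.\<close>
  have "w \<notin> set p"
  proof
    assume "w \<in> set p"
    then obtain q r where qr: "p = q @ w # r" by (meson split_list)
    then have "successively (\<lambda>x y. (x, y) \<in> parcs G) (q @ [w])"
      using p'(2) by (auto simp: successively_append_iff)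
    then have "graph_dist G v w \<le> length q"
      using graph_dist_walk[of "q @ [w]"] p' qr by (cases q) auto
    then show False using d p'(7) qr by simp
  qed
  then have sp: "shortest_path G v (p @ [w]) w"
    using p' w(1) V d by (auto simp: shortest_path_def path_between_iff successively_append_iff)
  \<comment> \<open>As \<open>u\<close> differs from \<open>v\<close>, it is the last entry of the
    tail of \<open>p\<close>, and appending \<open>w\<close> makes it internal.\<close>
  moreover have "u \<in> internal_verts (p @ [w])"
  proof (cases p)
    case (Cons a q)
    with p' uv(3) have "q \<noteq> []" "last q = u" by auto
    then show ?thesis using Cons by (auto simp: internal_verts_def butlast_append)
  qed (use p' in simp)
  ultimately have "\<not> positionable G X v w" using uv by (auto simp: positionable_def)
  moreover have "v \<noteq> w" using d graph_dist_eq_0_iff[of v v] V by auto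
  ultimately show False using X uv V(3) unfolding outer_general_position_def by blast
qed

text \<open>Let \<open>x \<in> X\<close> be internal to a shortest path from \<open>u\<close> to
  \<open>v\<close>, followed by \<open>y\<close>. Maximal distance puts \<open>y\<close> no farther
  from \<open>u\<close> than \<open>x\<close>, so going to \<open>v\<close> through \<open>y\<close>
  saves a step, a contradiction. As \<open>v\<close> is arbitrary, this serves both clauses of outer
  general position.\<close>

lemma positionable_if_maximally_distant:
  assumes X: "X \<subseteq> pverts G"
    and md: "\<And>x. x \<in> X \<Longrightarrow> x \<noteq> u \<Longrightarrow> maximally_distant G x u"
  shows "positionable G X u v"
proof -
  have False if p: "shortest_path G u p v" and x: "x \<in> internal_verts p" "x \<in> X" for p x
  proof -
    have p': "set p \<subseteq> pverts G" "successively (\<lambda>x y. (x, y) \<in> parcs G) p"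
      "p \<noteq> []" "distinct p" "hd p = u" "last p = v" "length p = Suc (graph_dist G u v)"
      using p by (auto simp: shortest_path_def path_between_iff) (metis Suc_pred length_greater_0_conv)
    obtain t where t: "p = u # t" using p' by (cases p) auto
    with x have "x \<in> set (butlast t)" "t \<noteq> []" by (auto simp: internal_verts_def)
    then obtain q r where qr: "butlast t = q @ x # r" by (meson split_list)
    then have "t = q @ x # r @ [v]"
      using \<open>t \<noteq> []\<close> t p'(6) append_butlast_last_id[of t] by auto
    \<comment> \<open>The successor \<open>y\<close> of \<open>x\<close> is \<open>v\<close> itself
      if \<open>r\<close> is empty.\<close>
    then obtain y s where pp: "p = u # q @ x # y # s"
      using t by (cases r) auto
    have V: "u \<in> pverts G" "x \<in> pverts G" "y \<in> pverts G" "v \<in> pverts G" and xy: "(x, y) \<in> parcs G"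
      using p' pp last_in_set[OF p'(3)] by (auto simp: successively_append_iff successively_Cons)
    have "x \<noteq> u" using p'(4) pp by auto
    have "graph_dist G y v \<le> length s"
      using graph_dist_walk[of "y # s"] p' pp
      by (auto simp: successively_append_iff successively_Cons)
    moreover have "graph_dist G u v = length q + length s + 2"
      using p'(7) pp by simp
    moreover have "graph_dist G u v \<le> graph_dist G u y + graph_dist G y v"
      using graph_dist_triangle V by simp
    moreover have "successively (\<lambda>x y. (x, y) \<in> parcs G) (u # q @ [x])"
      using p'(2) successively_append_iff[of _ "u # q @ [x]" "y # s"] pp by simp
    then have "graph_dist G u x \<le> length q + 1"
      using graph_dist_walk[of "u # q @ [x]"] p'(1) pp by simp
    moreover have "graph_dist G u y \<le> graph_dist G u x"
      using md[OF x(2) \<open>x \<noteq> u\<close>] xy graph_dist_commute[OF V(1,2)]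
      unfolding maximally_distant_def by simp
    ultimately show False by simp
  qed
  then show ?thesis unfolding positionable_def by blast
qed

text \<open>Ranging over ordered pairs makes the maximal distance mutual.\<close>

lemma outer_general_position_iff:
  "outer_general_position G X \<longleftrightarrow>
     X \<subseteq> pverts G \<and> (\<forall>u\<in>X. \<forall>v\<in>X. u \<noteq> v \<longrightarrow> maximally_distant G u v)"
proof
  assume X: "outer_general_position G X"
  then show "X \<subseteq> pverts G \<and> (\<forall>u\<in>X. \<forall>v\<in>X. u \<noteq> v \<longrightarrow> maximally_distant G u v)"
    using maximally_distant_if_positionable[OF X] by (simp add: outer_general_position_def)
next
  assume X: "X \<subseteq> pverts G \<and> (\<forall>u\<in>X. \<forall>v\<in>X. u \<noteq> v \<longrightarrow> maximally_distant G u v)"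
  then have "positionable G X u v" if "u \<in> X" for u v
    using positionable_if_maximally_distant[of X u v] that by simp
  then show "outer_general_position G X"
    using X by (simp add: outer_general_position_def)
qed

section \<open>Extremal sets and the boundary\<close>

lemma finite_card_outer_general_position: "finite {card X | X. outer_general_position G X}"
  by (rule finite_subset[of _ "card ` Pow (pverts G)"])
    (auto simp: outer_general_position_def)

lemma card_le_gp_outer: "outer_general_position G X \<Longrightarrow> card X \<le> gp_outer G"
  unfolding gp_outer_def by (rule Max_ge[OF finite_card_outer_general_position]) blast

lemma gp_outer_attained: "\<exists>X. outer_general_position G X \<and> card X = gp_outer G"
proof -
  \<comment> \<open>The empty set ensures that the maximum is taken over a nonempty set.\<close>
  have "outer_general_position G {}" by (simp add: outer_general_position_iff)
  then have "gp_outer G \<in> {card X | X. outer_general_position G X}"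
    unfolding gp_outer_def by (intro Max_in[OF finite_card_outer_general_position]) blast
  then show ?thesis by auto
qed

lemma finite_graph_boundary: "finite (graph_boundary G)"
  by (simp add: graph_boundary_def)

text \<open>Two distinct vertices at the largest distance in \<open>G\<close> are mutually maximally
  distant.\<close>

lemma graph_boundary_nonempty:
  assumes "card (pverts G) \<ge> 2"
  shows "graph_boundary G \<noteq> {}"
proof -
  let ?P = "{(x, y) \<in> pverts G \<times> pverts G. x \<noteq> y}"
  have "\<exists>x\<in>pverts G. \<exists>y\<in>pverts G. x \<noteq> y"
    using assms by (meson card_2_iff' obtain_subset_with_card_n subset_iff)
  then have ne: "?P \<noteq> {}" by auto
  have fin: "finite ?P" by (rule finite_subset[of _ "pverts G \<times> pverts G"]) auto
  let ?M = "Max (case_prod (graph_dist G) ` ?P)"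
  have "?M \<in> case_prod (graph_dist G) ` ?P"
    using fin ne by (intro Max_in) auto
  moreover have "graph_dist G x y \<le> ?M" if "x \<in> pverts G" "y \<in> pverts G" "x \<noteq> y" for x y
    using fin that by (intro Max_ge) (auto intro: rev_image_eqI)
  ultimately obtain u v where uv: "u \<in> pverts G" "v \<in> pverts G" "u \<noteq> v"
    and max: "\<And>x y. x \<in> pverts G \<Longrightarrow> y \<in> pverts G \<Longrightarrow> x \<noteq> y \<Longrightarrow> graph_dist G x y \<le> graph_dist G u v"
    by force
  have max': "graph_dist G x y \<le> graph_dist G u v" if "x \<in> pverts G" "y \<in> pverts G" for x y
    using max that by (cases "x = y") auto
  then have "mutually_maximally_distant G u v"
    using uv graph_dist_commute[OF uv(1,2)]
    by (auto simp: mutually_maximally_distant_def maximally_distant_def dest: in_arcsD2)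
  then show ?thesis using uv by (auto simp: graph_boundary_def)
qed

lemma outer_general_position_boundary:
  assumes "outer_general_position G X" "u \<in> X" "v \<in> X" "u \<noteq> v"
  shows "u \<in> graph_boundary G"
  using assms
  by (auto simp: outer_general_position_iff graph_boundary_def mutually_maximally_distant_def)

text \<open>A set with two members lies in the boundary; for a smaller one it is enough that the
  boundary is nonempty.\<close>

lemma gp_outer_le_boundary_number:
  assumes "card (pverts G) \<ge> 2"
  shows "gp_outer G \<le> boundary_number G"
proof -
  obtain X where X: "outer_general_position G X" "card X = gp_outer G"
    using gp_outer_attained by blast
  have b: "boundary_number G \<ge> 1"
    using graph_boundary_nonempty[OF assms] finite_graph_boundary
    by (simp add: boundary_number_def Suc_leI card_gt_0_iff)
  show ?thesis
  proof (cases "\<exists>u v. u \<in> X \<and> v \<in> X \<and> u \<noteq> v")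
    case True
    then have "X \<subseteq> graph_boundary G"
      using outer_general_position_boundary[OF X(1)] by blast
    then show ?thesis
      using X(2) card_mono[OF finite_graph_boundary, of X] by (simp add: boundary_number_def)
  next
    case False
    then have "X = {} \<or> (\<exists>x. X = {x})" by blast
    then have "card X \<le> 1" by auto
    then show ?thesis using X(2) b by simp
  qed
qed

end

section \<open>The strong product\<close>

text \<open>A reflexive step of the product is exactly a pair of reflexive steps of the factors, so
  walks of a common length project and combine.\<close>

lemma relpow_strong_product:
  assumes "pair_graph G" "pair_graph H" and "g \<in> pverts G" "h \<in> pverts H"
  shows "((g, h), (g', h')) \<in> (parcs (G \<boxtimes> H) \<union> Id) ^^ n \<longleftrightarrow>
    (g, g') \<in> (parcs G \<union> Id) ^^ n \<and> (h, h') \<in> (parcs H \<union> Id) ^^ n"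
proof -
  interpret G: pair_graph G by fact
  interpret H: pair_graph H by fact
  show ?thesis
  proof (induction n arbitrary: g' h')
    case (Suc n)
    \<comment> \<open>A product arc with one idle coordinate requires that coordinate to be a vertex
      of its factor, so membership is carried along the walk.\<close>
    have GV: "x \<in> pverts G" if "(g, x) \<in> (parcs G \<union> Id) ^^ m" for m x
      using that assms(3) by (induction m arbitrary: x) (auto dest: G.in_arcsD2)
    have HV: "x \<in> pverts H" if "(h, x) \<in> (parcs H \<union> Id) ^^ m" for m x
      using that assms(4) by (induction m arbitrary: x) (auto dest: H.in_arcsD2)
    have step: "((x, y), (g', h')) \<in> parcs (G \<boxtimes> H) \<union> Id \<longleftrightarrow>
        (x, g') \<in> parcs G \<union> Id \<and> (y, h') \<in> parcs H \<union> Id" if "x \<in> pverts G" "y \<in> pverts H" for x y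
      using that by (auto simp: strong_product_def)
    have "((g, h), (g', h')) \<in> (parcs (G \<boxtimes> H) \<union> Id) ^^ Suc n \<longleftrightarrow>
        (\<exists>x y. ((g, h), (x, y)) \<in> (parcs (G \<boxtimes> H) \<union> Id) ^^ n \<and>
           ((x, y), (g', h')) \<in> parcs (G \<boxtimes> H) \<union> Id)"
      unfolding relpow.simps relcomp_unfold by auto
    also have "\<dots> \<longleftrightarrow> (\<exists>x y. (g, x) \<in> (parcs G \<union> Id) ^^ n \<and> (h, y) \<in> (parcs H \<union> Id) ^^ n \<and>
        (x, g') \<in> parcs G \<union> Id \<and> (y, h') \<in> parcs H \<union> Id)"
      unfolding Suc.IH using step GV HV by meson
    also have "\<dots> \<longleftrightarrow> (g, g') \<in> (parcs G \<union> Id) ^^ Suc n \<and> (h, h') \<in> (parcs H \<union> Id) ^^ Suc n"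
      unfolding relpow.simps relcomp_unfold by blast
    finally show ?case .
  qed auto
qed

section \<open>Distance in the strong product of connected graphs\<close>

locale connected_pair_graphs =
  G: connected_pair_graph G + H: connected_pair_graph H
  for G :: "'a pair_pre_digraph" and H :: "'b pair_pre_digraph"
begin

lemma pverts_strong_product [simp]: "pverts (G \<boxtimes> H) = pverts G \<times> pverts H"
  by (simp add: strong_product_def)

lemma connected_pair_graph_strong_product: "connected_pair_graph (G \<boxtimes> H)"
proof -
  have pg: "pair_graph (G \<boxtimes> H)"
    by (rule pair_graph_strong_product[OF G.pair_graph H.pair_graph])
  have "pverts G \<noteq> {}" "pverts H \<noteq> {}"
    using G.connected H.connected
    by (auto simp: Digraph_Component.connected_def strongly_connected_def)
  then obtain g h where gh: "g \<in> pverts G" "h \<in> pverts H" by blast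
  have "((g, h), z) \<in> (parcs (G \<boxtimes> H))\<^sup>*" if "z \<in> pverts (G \<boxtimes> H)" for z
  proof -
    obtain g' h' where z: "z = (g', h')" "g' \<in> pverts G" "h' \<in> pverts H"
      using \<open>z \<in> pverts (G \<boxtimes> H)\<close> by auto
    \<comment> \<open>Both factor walks fit into the larger distance; the shorter one waits.\<close>
    let ?n = "max (graph_dist G g g') (graph_dist H h h')"
    have "((g, h), z) \<in> (parcs (G \<boxtimes> H) \<union> Id) ^^ ?n"
      unfolding z(1) relpow_strong_product[OF G.pair_graph H.pair_graph gh]
      using z gh by (simp flip: G.graph_dist_le_iff H.graph_dist_le_iff)
    then show ?thesis by (auto simp: relpow_Un_Id dest: relpow_imp_rtrancl)
  qed
  then have "Digraph_Component.connected (with_proj (G \<boxtimes> H))"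
    using gh by (intro connected_with_projI[OF pg, of "(g, h)"]) auto
  then show ?thesis using pg by (simp add: connected_pair_graph_def connected_pair_graph_axioms_def)
qed

sublocale P: connected_pair_graph "G \<boxtimes> H"
  by (rule connected_pair_graph_strong_product)

text \<open>An upper bound on the product distance bounds both factor distances and conversely;
  numbers with the same upper bounds are equal.\<close>

lemma graph_dist_strong_product:
  assumes "g \<in> pverts G" "h \<in> pverts H" "g' \<in> pverts G" "h' \<in> pverts H"
  shows "graph_dist (G \<boxtimes> H) (g, h) (g', h') = max (graph_dist G g g') (graph_dist H h h')"
proof -
  have "graph_dist (G \<boxtimes> H) (g, h) (g', h') \<le> n \<longleftrightarrow>
      max (graph_dist G g g') (graph_dist H h h') \<le> n" for n
    using assms P.graph_dist_le_iff[of "(g, h)" "(g', h')" n] G.graph_dist_le_iff H.graph_dist_le_iff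
    by (simp add: relpow_strong_product[OF G.pair_graph H.pair_graph])
  then show ?thesis by (metis order_antisym order_refl)
qed

section \<open>The lower bound\<close>

text \<open>Move \<open>p\<close> to a neighbour. In a coordinate where \<open>p\<close> and
  \<open>q\<close> differ, maximal distance in the factor stops the distance from growing. Where
  they agree it becomes at most 1, which is within the positive maximum \<open>?m\<close>.\<close>

lemma outer_general_position_Times:
  assumes X: "outer_general_position G X" and Y: "outer_general_position H Y"
  shows "outer_general_position (G \<boxtimes> H) (X \<times> Y)"
  unfolding P.outer_general_position_iff
proof (intro conjI ballI impI)
  have XV: "X \<subseteq> pverts G" and YV: "Y \<subseteq> pverts H"
    using X Y by (auto simp: outer_general_position_def)
  then show "X \<times> Y \<subseteq> pverts (G \<boxtimes> H)" by auto
  fix p q assume "p \<in> X \<times> Y" "q \<in> X \<times> Y" and ne: "p \<noteq> q"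
  then obtain x y x' y' where pq: "p = (x, y)" "q = (x', y')" "x \<in> X" "y \<in> Y" "x' \<in> X" "y' \<in> Y"
    by auto
  then have V: "x \<in> pverts G" "y \<in> pverts H" "x' \<in> pverts G" "y' \<in> pverts H"
    using XV YV by auto
  let ?m = "max (graph_dist G x x') (graph_dist H y y')"
  have "graph_dist G x x' \<noteq> 0 \<or> graph_dist H y y' \<noteq> 0"
    using ne pq V G.graph_dist_eq_0_iff H.graph_dist_eq_0_iff by auto
  then have pos: "1 \<le> ?m"
    by linarith
  show "maximally_distant (G \<boxtimes> H) p q"
    unfolding maximally_distant_def
  proof (intro allI impI)
    fix z assume z: "(p, z) \<in> parcs (G \<boxtimes> H)"
    obtain w t where wt: "z = (w, t)" by (cases z)
    have W: "w \<in> pverts G" "t \<in> pverts H"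
      using P.in_arcsD2[OF z] wt by auto
    have wx: "w = x \<or> (x, w) \<in> parcs G" and ty: "t = y \<or> (y, t) \<in> parcs H"
      using z wt pq by (auto simp: strong_product_def)
    have "graph_dist G x' w \<le> ?m"
    proof (cases "x = x'")
      case True
      then have "graph_dist G x' w \<le> 1"
        using wx G.graph_dist_adj[of x w] V True by auto
      then show ?thesis using pos by linarith
    next
      case False
      then have "maximally_distant G x x'"
        using X pq G.outer_general_position_iff by simp
      then have "graph_dist G x' w \<le> graph_dist G x x'"
        using wx G.graph_dist_commute[OF V(1,3)] unfolding maximally_distant_def by auto
      then show ?thesis by simp
    qed
    moreover have "graph_dist H y' t \<le> ?m"
    proof (cases "y = y'")
      case True
      then have "graph_dist H y' t \<le> 1"
        using ty H.graph_dist_adj[of y t] V True by auto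
      then show ?thesis using pos by linarith
    next
      case False
      then have "maximally_distant H y y'"
        using Y pq H.outer_general_position_iff by simp
      then have "graph_dist H y' t \<le> graph_dist H y y'"
        using ty H.graph_dist_commute[OF V(2,4)] unfolding maximally_distant_def by auto
      then show ?thesis by simp
    qed
    ultimately show "graph_dist (G \<boxtimes> H) q z \<le> graph_dist (G \<boxtimes> H) p q"
      using pq wt V W by (simp add: graph_dist_strong_product)
  qed
qed

section \<open>From the product to boundary vertices of the factors\<close>

text \<open>Moving the first coordinate alone is a step of the product. If \<open>G\<close> realises
  the maximum, the bound on the product distance is a bound in \<open>G\<close>.\<close>

lemma maximally_distant_fst:
  assumes md: "maximally_distant (G \<boxtimes> H) (g, h) (g', h')"
    and V: "g \<in> pverts G" "h \<in> pverts H" "g' \<in> pverts G" "h' \<in> pverts H"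
    and le: "graph_dist H h h' \<le> graph_dist G g g'"
  shows "maximally_distant G g g'"
  unfolding maximally_distant_def
proof (intro allI impI)
  fix w assume w: "(g, w) \<in> parcs G"
  then have "((g, h), (w, h)) \<in> parcs (G \<boxtimes> H)" using V by (simp add: strong_product_def)
  then have "graph_dist (G \<boxtimes> H) (g', h') (w, h) \<le> graph_dist (G \<boxtimes> H) (g, h) (g', h')"
    using md by (simp add: maximally_distant_def)
  then show "graph_dist G g' w \<le> graph_dist G g g'"
    using V le G.in_arcsD2[OF w] by (simp add: graph_dist_strong_product)
qed

lemma maximally_distant_snd:
  assumes md: "maximally_distant (G \<boxtimes> H) (g, h) (g', h')"
    and V: "g \<in> pverts G" "h \<in> pverts H" "g' \<in> pverts G" "h' \<in> pverts H"
    and le: "graph_dist G g g' \<le> graph_dist H h h'"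
  shows "maximally_distant H h h'"
  unfolding maximally_distant_def
proof (intro allI impI)
  fix w assume w: "(h, w) \<in> parcs H"
  then have "((g, h), (g, w)) \<in> parcs (G \<boxtimes> H)" using V by (simp add: strong_product_def)
  then have "graph_dist (G \<boxtimes> H) (g', h') (g, w) \<le> graph_dist (G \<boxtimes> H) (g, h) (g', h')"
    using md by (simp add: maximally_distant_def)
  then show "graph_dist H h' w \<le> graph_dist H h h'"
    using V le H.in_arcsD2[OF w] by (simp add: graph_dist_strong_product)
qed

text \<open>The factor with the larger distance supplies the disjunct. That distance is positive
  because \<open>p \<noteq> q\<close>, so the coordinates differ there.\<close>

lemma outer_general_position_strong_product_boundary:
  assumes X: "outer_general_position (G \<boxtimes> H) X" and pq: "p \<in> X" "q \<in> X" "p \<noteq> q"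
  shows "fst p \<noteq> fst q \<and> fst p \<in> graph_boundary G \<and> fst q \<in> graph_boundary G \<or>
         snd p \<noteq> snd q \<and> snd p \<in> graph_boundary H \<and> snd q \<in> graph_boundary H"
proof -
  obtain g h g' h' where e: "p = (g, h)" "q = (g', h')" by (cases p, cases q)
  have V: "g \<in> pverts G" "h \<in> pverts H" "g' \<in> pverts G" "h' \<in> pverts H"
    using X pq(1,2) e unfolding outer_general_position_def by auto
  have md: "maximally_distant (G \<boxtimes> H) (g, h) (g', h')" "maximally_distant (G \<boxtimes> H) (g', h') (g, h)"
    using X[unfolded P.outer_general_position_iff] pq e by auto
  show ?thesis
  proof (cases "graph_dist H h h' \<le> graph_dist G g g'")
    case True
    then have "g \<noteq> g'"
      using pq(3) e V G.graph_dist_eq_0_iff H.graph_dist_eq_0_iff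
      by force
    moreover have "maximally_distant G g g'" "maximally_distant G g' g"
      using True maximally_distant_fst[OF md(1)] maximally_distant_fst[OF md(2)] V
        G.graph_dist_commute[OF V(1,3)] H.graph_dist_commute[OF V(2,4)] by simp_all
    ultimately show ?thesis
      using V e by (auto simp: graph_boundary_def mutually_maximally_distant_def)
  next
    case False
    then have "h \<noteq> h'"
      using V by auto
    moreover have "maximally_distant H h h'" "maximally_distant H h' h"
      using False maximally_distant_snd[OF md(1)] maximally_distant_snd[OF md(2)] V
        G.graph_dist_commute[OF V(1,3)] H.graph_dist_commute[OF V(2,4)] by simp_all
    ultimately show ?thesis
      using V e by (auto simp: graph_boundary_def mutually_maximally_distant_def)
  qed
qed

end

section \<open>Counting sets of pairs\<close>

lemma card_le_mult_if_fst_inj: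
  assumes fin: "finite A" "finite B" and ne: "B \<noteq> {}" and X: "fst ` X \<subseteq> A"
    and snd: "\<And>p q. p \<in> X \<Longrightarrow> q \<in> X \<Longrightarrow> p \<noteq> q \<Longrightarrow> fst p = fst q \<Longrightarrow> snd p \<in> B \<and> snd q \<in> B"
  shows "card X \<le> card A * card B"
proof -
  obtain b where b: "b \<in> B" using ne by blast
  \<comment> \<open>Distinct members with the same image would share the first coordinate, so both
    second coordinates would be in \<open>B\<close> and hence unchanged by
    \<open>?f\<close>.\<close>
  let ?f = "\<lambda>p. (fst p, if snd p \<in> B then snd p else b)"
  have "inj_on ?f X"
    by (intro inj_onI) (metis fst_conv snd snd_conv prod_eqI)
  moreover have "?f ` X \<subseteq> A \<times> B" using X b by auto
  ultimately have "card X \<le> card (A \<times> B)" using fin by (intro card_inj_on_le) auto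
  then show ?thesis by (simp add: card_cartesian_product)
qed

lemma card_le_mult_if_separated:
  assumes fin: "finite A" "finite B" and ne: "A \<noteq> {}" "B \<noteq> {}"
    and sep: "\<And>p q. p \<in> X \<Longrightarrow> q \<in> X \<Longrightarrow> p \<noteq> q \<Longrightarrow>
      fst p \<noteq> fst q \<and> fst p \<in> A \<and> fst q \<in> A \<or> snd p \<noteq> snd q \<and> snd p \<in> B \<and> snd q \<in> B"
  shows "card X \<le> card A * card B"
proof (cases "\<exists>p\<in>X. \<exists>q\<in>X. p \<noteq> q")
  case False
  then have "X = {} \<or> (\<exists>x. X = {x})" by blast
  then have "card X \<le> 1" by auto
  moreover have "1 \<le> card A * card B" using fin ne by (simp add: Suc_le_eq card_gt_0_iff)
  ultimately show ?thesis by (rule le_trans)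
next
  case True
  have "fst ` X \<subseteq> A \<or> snd ` X \<subseteq> B"
  proof (rule ccontr)
    assume "\<not> ?thesis"
    then obtain p q where pq: "p \<in> X" "fst p \<notin> A" "q \<in> X" "snd q \<notin> B" by blast
    \<comment> \<open>For \<open>p \<noteq> q\<close> both disjuncts fail, as
      \<open>fst p \<notin> A\<close> and \<open>snd q \<notin> B\<close>. The single vertex left
      has neither coordinate in place and cannot be separated from any \<open>r\<close>.\<close>
    then have "p = q" using sep by blast
    moreover obtain r where "r \<in> X" "r \<noteq> p" using True by metis
    ultimately show False using sep pq by blast
  qed
  then show ?thesis
  proof
    assume "fst ` X \<subseteq> A"
    then show ?thesis using fin ne sep by (intro card_le_mult_if_fst_inj) blast+
  next
    assume s: "snd ` X \<subseteq> B"
    \<comment> \<open>Swapping coordinates reduces this to the preceding case.\<close>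
    have "card (prod.swap ` X) \<le> card B * card A"
    proof (rule card_le_mult_if_fst_inj[OF fin(2,1) ne(1)])
      show "fst ` prod.swap ` X \<subseteq> B" using s by auto
      fix p q assume "p \<in> prod.swap ` X" "q \<in> prod.swap ` X" "p \<noteq> q" "fst p = fst q"
      then show "snd p \<in> A \<and> snd q \<in> A" using sep by fastforce
    qed
    then show ?thesis by (simp add: card_image mult.commute)
  qed
qed

section \<open>Block graphs\<close>

definition induced :: "'a pair_pre_digraph \<Rightarrow> 'a set \<Rightarrow> 'a pair_pre_digraph" where
  "induced G S = \<lparr>pverts = S, parcs = parcs G \<inter> S \<times> S\<rparr>"

lemma induced_sel [simp]: "pverts (induced G S) = S" "parcs (induced G S) = parcs G \<inter> S \<times> S"
  by (simp_all add: induced_def)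

lemma del_vert_induced: "pre_digraph.del_vert (with_proj (induced G S)) x = with_proj (induced G (S - {x}))"
  by (auto simp: pre_digraph.del_vert_def with_proj_def)

lemma pair_graph_induced:
  assumes "pair_graph G" "S \<subseteq> pverts G"
  shows "pair_graph (induced G S)"
proof -
  interpret pair_graph G by fact
  have "finite S" by (rule finite_subset[OF assms(2)]) simp
  moreover have "sym (parcs G \<inter> S \<times> S)" using arcs_symmetric by (auto simp: sym_def)
  ultimately show ?thesis
    by unfold_locales (auto simp: symmetric_def dest: no_loops)
qed

lemma subgraph_induced:
  assumes "pair_graph G" "S \<subseteq> pverts G"
  shows "subgraph (with_proj (induced G S)) (with_proj G)"
proof -
  interpret pair_graph G by fact
  interpret S: pair_graph "induced G S" by (rule pair_graph_induced[OF assms])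
  show ?thesis using assms(2) S.wf_digraph wf_digraph by (auto simp: subgraph_def)
qed

text \<open>The vertex \<open>u\<close> closes the path \<open>p\<close> to a cycle. Deleting
  \<open>u\<close> leaves the path; deleting \<open>y\<close> from \<open>p\<close> leaves two arms,
  each still attached to \<open>u\<close> by its outer end.\<close>

lemma two_connected_cycle:
  assumes G: "pair_graph G" and p: "successively (\<lambda>x y. (x, y) \<in> parcs G) p" "distinct p"
      "length p \<ge> 2" "u \<notin> set p"
    and a: "(u, hd p) \<in> parcs G" and b: "(u, last p) \<in> parcs G"
  shows "two_connected (with_proj (induced G (insert u (set p))))"
proof -
  interpret pair_graph G by fact
  let ?S = "insert u (set p)"
  let ?E = "\<lambda>T. parcs G \<inter> T \<times> T"
  have ne: "p \<noteq> []" using p(3) by auto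
  have SV: "?S \<subseteq> pverts G"
    using successively_arcs_verts[OF G p(1)] a by (auto dest: in_arcsD1 in_arcsD2)
  \<comment> \<open>The set \<open>T\<close> is kept general to serve both the whole cycle and the
    cycle without a vertex.\<close>
  have fwd: "(u, x) \<in> (?E T)\<^sup>*"
    if q: "successively (\<lambda>x y. (x, y) \<in> parcs G) q" "x \<in> set q" "insert u (set q) \<subseteq> T"
      and e: "(u, hd q) \<in> parcs G" for q x T
  proof -
    have "(u, hd q) \<in> ?E T" using that by (cases q) auto
    then show ?thesis using successively_rtrancl[of "parcs G" q x T] q by (auto intro: converse_rtrancl_into_rtrancl)
  qed
  have bwd: "(u, x) \<in> (?E T)\<^sup>*"
    if q: "successively (\<lambda>x y. (x, y) \<in> parcs G) q" "x \<in> set q" "insert u (set q) \<subseteq> T"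
      and e: "(u, last q) \<in> parcs G" for q x T
  proof (rule fwd[of "rev q"])
    show "successively (\<lambda>x y. (x, y) \<in> parcs G) (rev q)"
      unfolding successively_rev using q(1) by (rule successively_mono) (rule arcs_symmetric)
  qed (use that in \<open>auto simp: hd_rev\<close>)
  have conn: "Digraph_Component.connected (with_proj (induced G (?S - {y})))" if y: "y \<in> ?S" for y
  proof -
    have sub: "?S - {y} \<subseteq> pverts G" using SV by auto
    consider "y = u" | "y \<in> set p" using y by blast
    then show ?thesis
    proof cases
      case 1
      then have S: "?S - {y} = set p" using p(4) by auto
      show ?thesis unfolding S
        using successively_rtrancl[OF p(1)] ne SV
        by (intro connected_with_projI[OF pair_graph_induced[OF G], of _ "hd p"]) auto
    next
      case 2
      then obtain q r where qr: "p = q @ y # r" by (meson split_list)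
      have T: "insert u (set q) \<subseteq> ?S - {y}" "insert u (set r) \<subseteq> ?S - {y}"
        using qr p by auto
      have s: "successively (\<lambda>x y. (x, y) \<in> parcs G) q" "successively (\<lambda>x y. (x, y) \<in> parcs G) r"
        using p(1) qr by (auto simp: successively_append_iff successively_Cons)
      have "(u, x) \<in> (?E (?S - {y}))\<^sup>*" if "x \<in> ?S - {y}" for x
      proof -
        from that consider "x = u" | "x \<in> set q" | "x \<in> set r" using qr by auto
        then show ?thesis
        proof cases
          case 2
          then show ?thesis using fwd[OF s(1) 2 T(1)] a qr by (cases q) auto
        next
          case 3
          then show ?thesis using bwd[OF s(2) 3 T(2)] b qr by (cases r) auto
        qed auto
      qed
      then show ?thesis
        using T by (intro connected_with_projI[OF pair_graph_induced[OF G sub], of u]) auto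
    qed
  qed
  have "Digraph_Component.connected (with_proj (induced G ?S))"
    using fwd[OF p(1) _ subset_refl a]
    by (intro connected_with_projI[OF pair_graph_induced[OF G SV], of u]) auto
  moreover have "card ?S > 2" using p by (simp add: distinct_card)
  moreover have "graph (with_proj (induced G ?S))"
    by (rule pair_graph.pair_graphD_graph[OF pair_graph_induced[OF G SV]])
  ultimately show ?thesis
    using conn unfolding two_connected_def del_vert_induced by simp
qed

text \<open>Among the two-connected subgraphs of \<open>G\<close> above \<open>B\<close>, one with
  the most vertices plus arcs is maximal: anything above it has equal vertex and arc sets.\<close>

lemma two_connected_extends_to_block:
  assumes G: "pair_graph G" and B: "subgraph (with_proj B) (with_proj G)" "two_connected (with_proj B)"
  shows "\<exists>C. block G C \<and> pverts B \<subseteq> pverts C \<and> parcs C \<subseteq> parcs G"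
proof -
  interpret pair_graph G by fact
  let ?Q = "\<lambda>C. subgraph (with_proj C) (with_proj G) \<and> two_connected (with_proj C) \<and> subgraph (with_proj B) (with_proj C)"
  let ?m = "\<lambda>C :: 'a pair_pre_digraph. card (pverts C) + card (parcs C)"
  have "?Q B"
    using B by (auto simp: subgraph_def)
  moreover have "\<forall>C. ?Q C \<longrightarrow> ?m C < Suc (?m G)"
    by (auto simp: less_Suc_eq_le subgraph_def intro!: add_mono card_mono)
  ultimately obtain C where C: "?Q C" "\<forall>D. ?Q D \<longrightarrow> ?m D \<le> ?m C"
    using ex_has_greatest_nat[of ?Q B ?m] by blast
  have "pre_digraph.max_subgraph (with_proj G) two_connected (with_proj C)"
  proof (rule pre_digraph.max_subgraphI)
    fix K assume K: "with_proj C \<noteq> K" "subgraph (with_proj C) K" "subgraph K (with_proj G)"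
    show "\<not> two_connected K"
    proof
      assume tc: "two_connected K"
      \<comment> \<open>Maximality ranges over digraphs \<open>K\<close> with arbitrary end maps.
        Being a subgraph of \<open>G\<close> forces these to be \<open>fst\<close> and
        \<open>snd\<close>, so \<open>K\<close> comes from a pair digraph.\<close>
      define D where "D = \<lparr>pverts = verts K, parcs = arcs K\<rparr>"
      have "tail K = fst" "head K = snd"
        using K(3) by (auto simp: subgraph_def compatible_def)
      then have KD: "K = with_proj D" by (simp add: D_def with_proj_def)
      have sub: "pverts C \<subseteq> pverts D" "parcs C \<subseteq> parcs D" "pverts D \<subseteq> pverts G" "parcs D \<subseteq> parcs G"
        using K KD by (auto simp: subgraph_def)
      have "?Q D" using tc K C(1) KD subgraph_trans by metis
      then have le: "?m D \<le> ?m C" using C(2) by blast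
      have fin: "finite (pverts D)" "finite (parcs D)"
        using finite_subset[OF sub(3)] finite_subset[OF sub(4)] by auto
      then have "card (pverts C) \<le> card (pverts D)" "card (parcs C) \<le> card (parcs D)"
        using sub by (auto intro: card_mono)
      then have "card (pverts D) \<le> card (pverts C)" "card (parcs D) \<le> card (parcs C)"
        using le by auto
      then have "pverts C = pverts D" "parcs C = parcs D"
        using sub fin card_seteq by blast+
      then show False using K(1) KD by (simp add: with_proj_def)
    qed
  qed (use C in auto)
  then have "block G C" by (simp add: block_def)
  then show ?thesis using C(1) by (auto simp: subgraph_def)
qed

text \<open>A walk from \<open>a\<close> to \<open>b\<close> avoiding \<open>u\<close> shortens to a
  path, which \<open>u\<close> closes to a cycle. The cycle lies in a block, and blocks are
  complete.\<close>

lemma block_graph_adjacent: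
  assumes G: "block_graph G" and a: "(u, a) \<in> parcs G" and b: "(u, b) \<in> parcs G" and ne: "a \<noteq> b"
    and ab: "(a, b) \<in> (parcs G \<inter> (- {u}) \<times> (- {u}))\<^sup>*"
  shows "(a, b) \<in> parcs G"
proof -
  have pg: "pair_graph G" using G by (simp add: block_graph_def)
  interpret pair_graph G by fact
  have au: "a \<noteq> u" "a \<in> pverts G" "u \<in> pverts G"
    using a no_loops' in_arcsD1 in_arcsD2 by auto
  \<comment> \<open>Shortening the walk inside \<open>G\<close> without \<open>u\<close> yields a
    path that avoids \<open>u\<close>.\<close>
  let ?K = "induced G (pverts G - {u})"
  have "parcs G \<inter> (- {u}) \<times> (- {u}) \<subseteq> parcs ?K"
    by (auto dest: in_arcsD1 in_arcsD2)
  then have "(a, b) \<in> (parcs ?K)\<^sup>*" using ab rtrancl_mono by blast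
  then obtain n where "(a, b) \<in> parcs ?K ^^ n" using rtrancl_imp_relpow by blast
  then obtain w where w: "successively (\<lambda>x y. (x, y) \<in> parcs ?K) w" "w \<noteq> []" "hd w = a" "last w = b"
    using relpow_successively by metis
  have "pair_graph ?K" by (rule pair_graph_induced[OF pg]) auto
  then have "vwalk w (with_proj ?K)"
    unfolding vwalk_with_proj_iff
    using w successively_arcs_verts[of ?K w] au by simp
  then obtain p where p: "vpath p (with_proj ?K)" "hd p = a" "last p = b"
    using vwalk_imp_ex_vpath w(3,4) by metis
  then have p': "set p \<subseteq> pverts G - {u}" "successively (\<lambda>x y. (x, y) \<in> parcs G) p" "p \<noteq> []" "distinct p"
    by (auto simp: vpath_def vwalk_with_proj_iff elim: successively_mono)
  have "length p \<ge> 2"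
    using p(2,3) p'(3) ne by (cases p; cases "tl p") auto
  then have "two_connected (with_proj (induced G (insert u (set p))))"
    using p p' a b by (intro two_connected_cycle[OF pg]) auto
  moreover have "subgraph (with_proj (induced G (insert u (set p)))) (with_proj G)"
    using p' au by (intro subgraph_induced[OF pg]) auto
  ultimately obtain C where C: "block G C" "insert u (set p) \<subseteq> pverts C" "parcs C \<subseteq> parcs G"
    using two_connected_extends_to_block[OF pg, of "induced G (insert u (set p))"]
    unfolding induced_sel by blast
  then have "complete_digraph (card (pverts C)) (with_proj C)"
    using G by (simp add: block_graph_def)
  then have "parcs C = {(x, y). (x, y) \<in> pverts C \<times> pverts C \<and> x \<noteq> y}"
    by (simp add: complete_digraph_pair_def)
  moreover have "a \<in> set p" "b \<in> set p" using p p'(3) by auto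
  ultimately show ?thesis using C ne by auto
qed

section \<open>Boundary vertices of block graphs\<close>

context connected_pair_graph
begin

text \<open>Going back from \<open>w\<close> along a shortest path, every earlier vertex is strictly
  closer to \<open>v\<close> than \<open>u\<close> is, so \<open>u\<close> is never met.\<close>

lemma reachable_avoiding:
  assumes "v \<in> pverts G" "u \<in> pverts G" "v \<noteq> u"
    and "w \<in> pverts G" "w \<noteq> u" "graph_dist G v w \<le> graph_dist G v u"
  shows "(v, w) \<in> (parcs G \<inter> (- {u}) \<times> (- {u}))\<^sup>*"
  using assms(4-)
proof (induction "graph_dist G v w" arbitrary: w rule: less_induct)
  case less
  show ?case
  proof (cases "v = w")
    case False
    then obtain x where x: "(x, w) \<in> parcs G" "Suc (graph_dist G v x) \<le> graph_dist G v w"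
      using graph_dist_pred assms(1) less.prems(1) by metis
    then have "x \<in> pverts G" "x \<noteq> u" using less.prems by (auto dest: in_arcsD1)
    then have "(v, x) \<in> (parcs G \<inter> (- {u}) \<times> (- {u}))\<^sup>*"
      using less x by auto
    then show ?thesis
      using x(1) \<open>x \<noteq> u\<close> less.prems(2) by (auto intro: rtrancl_into_rtrancl)
  qed auto
qed

text \<open>No neighbour of \<open>u\<close> is farther from \<open>v\<close> than \<open>u\<close>,
  so \<open>a\<close> and \<open>b\<close> are joined through \<open>v\<close> without passing
  \<open>u\<close>.\<close>

lemma block_graph_neighbours_clique:
  assumes G: "block_graph G" and uv: "u \<in> pverts G" "v \<in> pverts G" "v \<noteq> u"
    and md: "maximally_distant G u v"
    and a: "(u, a) \<in> parcs G" and b: "(u, b) \<in> parcs G" and "a \<noteq> b"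
  shows "(a, b) \<in> parcs G"
proof (rule block_graph_adjacent[OF G a b \<open>a \<noteq> b\<close>])
  let ?R = "parcs G \<inter> (- {u}) \<times> (- {u})"
  have reach: "(v, x) \<in> ?R\<^sup>*" if "(u, x) \<in> parcs G" for x
  proof (rule reachable_avoiding)
    show "graph_dist G v x \<le> graph_dist G v u"
      using md that graph_dist_commute uv by (auto simp: maximally_distant_def)
  qed (use uv that no_loops' in_arcsD2 in auto)
  have "sym ?R" using arcs_symmetric by (auto simp: sym_def)
  then have "sym (?R\<^sup>*)" by (rule sym_rtrancl)
  then show "(a, b) \<in> ?R\<^sup>*"
    using reach[OF a] reach[OF b] by (meson rtrancl_trans symD)
qed

text \<open>A neighbour \<open>x\<close> of \<open>u\<close> one step closer to \<open>v\<close>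
  equals or is adjacent to any other neighbour \<open>w\<close>. The step from \<open>x\<close> to
  \<open>w\<close> regains at most what \<open>x\<close> saved.\<close>

lemma maximally_distant_if_neighbours_clique:
  assumes u: "u \<in> pverts G" and v: "v \<in> pverts G" "v \<noteq> u"
    and clique: "\<And>a b. (u, a) \<in> parcs G \<Longrightarrow> (u, b) \<in> parcs G \<Longrightarrow> a \<noteq> b \<Longrightarrow> (a, b) \<in> parcs G"
  shows "maximally_distant G u v"
  unfolding maximally_distant_def
proof (intro allI impI)
  fix w assume w: "(u, w) \<in> parcs G"
  obtain x where x: "(x, u) \<in> parcs G" "Suc (graph_dist G v x) \<le> graph_dist G v u"
    by (rule graph_dist_pred[OF v(1) u v(2)])
  have V: "x \<in> pverts G" "w \<in> pverts G" using x w in_arcsD1 in_arcsD2 by auto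
  have "graph_dist G x w \<le> 1"
    using clique[OF arcs_symmetric[OF x(1)] w] graph_dist_adj graph_dist_eq_0_iff[of x w] V
    by (cases "x = w") auto
  then show "graph_dist G v w \<le> graph_dist G u v"
    using graph_dist_triangle[of v x w] x(2) V u v graph_dist_commute[of u v] by simp
qed

lemma block_graph_gp_outer:
  assumes "block_graph G" "card (pverts G) \<ge> 2"
  shows "gp_outer G = boundary_number G"
proof -
  have "outer_general_position G (graph_boundary G)"
    unfolding outer_general_position_iff
  proof (intro conjI ballI impI)
    show "graph_boundary G \<subseteq> pverts G" by (auto simp: graph_boundary_def)
    fix u v assume "u \<in> graph_boundary G" "v \<in> graph_boundary G" "u \<noteq> v"
    \<comment> \<open>The vertex \<open>v'\<close> that puts \<open>u\<close> in the boundary may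
      differ from \<open>v\<close>; it makes the neighbours of \<open>u\<close> a clique, which
      gives maximal distance from every other vertex.\<close>
    moreover from this obtain v' where "v' \<in> pverts G" "v' \<noteq> u" "maximally_distant G u v'"
      by (auto simp: graph_boundary_def mutually_maximally_distant_def)
    ultimately show "maximally_distant G u v"
      using block_graph_neighbours_clique[OF assms(1), of u v']
      by (intro maximally_distant_if_neighbours_clique) (auto simp: graph_boundary_def)
  qed
  then have "boundary_number G \<le> gp_outer G"
    using card_le_gp_outer by (simp add: boundary_number_def)
  then show ?thesis using gp_outer_le_boundary_number[OF assms(2)] by simp
qed

end

theorem theorem4p4:
  fixes G :: "'a pair_pre_digraph" and H :: "'b pair_pre_digraph"
  assumes "pair_graph G" and "pair_graph H"
    and "Digraph_Component.connected (with_proj G)"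
    and "Digraph_Component.connected (with_proj H)"
    and "card (pverts G) \<ge> 2" and "card (pverts H) \<ge> 2"
  shows "gp_outer G * gp_outer H \<le> gp_outer (G \<boxtimes> H) \<and>
         gp_outer (G \<boxtimes> H) \<le> boundary_number G * boundary_number H \<and>
         (block_graph G \<and> block_graph H \<longrightarrow>
            gp_outer G * gp_outer H = boundary_number G * boundary_number H)"
proof -
  interpret connected_pair_graphs G H
    by (intro connected_pair_graphs.intro connected_pair_graph.intro
        connected_pair_graph_axioms.intro assms)
  obtain X Y where "outer_general_position G X" "card X = gp_outer G"
      "outer_general_position H Y" "card Y = gp_outer H"
    using G.gp_outer_attained H.gp_outer_attained by blast
  then have lower: "gp_outer G * gp_outer H \<le> gp_outer (G \<boxtimes> H)"
    using P.card_le_gp_outer[OF outer_general_position_Times]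
    by (metis card_cartesian_product)
  obtain Z where Z: "outer_general_position (G \<boxtimes> H) Z" "card Z = gp_outer (G \<boxtimes> H)"
    using P.gp_outer_attained by blast
  \<comment> \<open>The two boundaries are the sets that separate the members of
    \<open>Z\<close>.\<close>
  have "card Z \<le> card (graph_boundary G) * card (graph_boundary H)"
    using outer_general_position_strong_product_boundary[OF Z(1)]
      G.graph_boundary_nonempty[OF assms(5)] H.graph_boundary_nonempty[OF assms(6)]
    by (intro card_le_mult_if_separated G.finite_graph_boundary H.finite_graph_boundary)
  then have "gp_outer (G \<boxtimes> H) \<le> boundary_number G * boundary_number H"
    using Z(2) by (simp add: boundary_number_def)
  then show ?thesis
    using lower G.block_graph_gp_outer[OF _ assms(5)] H.block_graph_gp_outer[OF _ assms(6)] by simp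
qed

end
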